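(* Let $\Omega\subset B(\mathcal H)^d$ be an NC domain and $f:\Omega\to B(\mathcal H)^r$ an NC function (with $d,r\ge1$ arbitrary). Then $f$ is injective if and only if $Df(x):B(\mathcal H)^d\to B(\mathcal H)^r$ is injective for every $x\in\Omega$.
   Context: Throughout, $\mathcal H$ is an infinite-dimensional separable complex Hilbert space, $B(\mathcal H)$ the bounded operators with the operator norm, and $\mathcal H^{(l)}$ ($l\in\mathbb N\cup\{\infty\}$) the direct sum of $l$ copies of $\mathcal H$. $B(\mathcal H)^d$ has the norm $\|x\|=\max_i\|x^i\|$. Operations on tuples are componentwise: for bounded invertible linear $s:\mathcal H\to\mathcal H^{(l)}$ and $z\in B(\mathcal H^{(l)})^d$, $s^{-1}zs=(s^{-1}z^1s,\dots,s^{-1}z^ds)$; for a finite or countable uniformly bounded sequence $x_1,x_2,\dots$ in $B(\mathcal H)^d$ of length $l$, $\bigoplus_n x_n\in B(\mathcal H^{(l)})^d$ has $i$-th entry $\bigoplus_n x_n^i$; block matrices of tuples are defined entrywise per coordinate. A set is unitarily invariant if $u^*xu$ lies in it for each of its elements $x$ and each unitary $u\in B(\mathcal H)$. NC domain: $\Omega\subset B(\mathcal H)^d$ is an NC domain if there are subsets $\Omega_1,\Omega_2,\dots$ of $\Omega$ with (1) $\Omega_k\subset\mathrm{int}\,\Omega_{k+1}$ (norm interior) and $\Omega=\bigcup_k\Omega_k$; (2) each $\Omega_k$ norm-bounded and unitarily invariant; (3) for every sequence $x_1,x_2,\dots$ in $\Omega_k$ of length $l\in\mathbb N\cup\{\infty\}$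 there is a unitary $u:\mathcal H\to\mathcal H^{(l)}$ with $u^{-1}(\bigoplus_n x_n)u\in\Omega_k$. NC function: $f:\Omega\to B(\mathcal H)^r$ on an NC domain is NC if whenever $x,y\in\Omega$ and $s:\mathcal H\to\mathcal H^{(2)}$ is bounded, linear, invertible with $s^{-1}\begin{bmatrix}x&0\\0&y\end{bmatrix}s\in\Omega$, then $f\Big(s^{-1}\begin{bmatrix}x&0\\0&y\end{bmatrix}s\Big)=s^{-1}\begin{bmatrix}f(x)&0\\0&f(y)\end{bmatrix}s$. Every NC function is Fréchet differentiable; $Df(x)$ denotes its Fréchet derivative at $x$. *)

theory Defs
  imports "HOL-Analysis.Analysis" "HOL-Library.Extended_Nat"
begin

text \<open>
Model of the complex Hilbert space H: a real Hilbert space 'h (real_inner + complete)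
together with an orthogonal complex structure J (multiplication by i).
Complex-linear maps are the real-linear maps commuting with J.
\<close>

definition complex_structure :: "('h::real_inner \<Rightarrow> 'h) \<Rightarrow> bool" where
  "complex_structure J \<longleftrightarrow> linear J \<and> (\<forall>v. J (J v) = - v) \<and> (\<forall>v w. inner (J v) (J w) = inner v w)"

definition sep_inf_hilbert :: "('h::{real_inner,complete_space} \<Rightarrow> 'h) \<Rightarrow> bool" where
  "sep_inf_hilbert J \<longleftrightarrow> complex_structure J \<and> separable_space (euclidean :: 'h topology)
     \<and> \<not> (\<exists>S::'h set. finite S \<and> span S = UNIV)"

definition BH :: "('h::real_normed_vector \<Rightarrow> 'h) \<Rightarrow> ('h \<Rightarrow>\<^sub>L 'h) set" where
  "BH J = {T. \<forall>v. blinfun_apply T (J v) = J (blinfun_apply T v)}"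

definition BHt :: "('h::real_normed_vector \<Rightarrow> 'h) \<Rightarrow> (('h \<Rightarrow>\<^sub>L 'h) ^ 'd) set" where
  "BHt J = {x. \<forall>i. x $ i \<in> BH J}"

definition bint :: "('h::real_normed_vector \<Rightarrow> 'h) \<Rightarrow> (('h \<Rightarrow>\<^sub>L 'h) ^ 'd) set \<Rightarrow> (('h \<Rightarrow>\<^sub>L 'h) ^ 'd) set" where
  "bint J S = {x \<in> BHt J. \<exists>e>0. \<forall>y \<in> BHt J. dist y x < e \<longrightarrow> y \<in> S}"

definition unitary_op :: "('h::real_normed_vector \<Rightarrow> 'h) \<Rightarrow> ('h \<Rightarrow> 'h) \<Rightarrow> bool" where
  "unitary_op J u \<longleftrightarrow> linear u \<and> (\<forall>v. u (J v) = J (u v)) \<and> (\<forall>v. norm (u v) = norm v) \<and> surj u"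

definition Hl :: "enat \<Rightarrow> (nat \<Rightarrow> 'h::real_normed_vector) set" where
  "Hl l = {w. (\<forall>n. \<not> (enat n < l) \<longrightarrow> w n = 0) \<and> summable (\<lambda>n. (norm (w n))\<^sup>2)}"

definition unitary_to :: "('h::real_normed_vector \<Rightarrow> 'h) \<Rightarrow> enat \<Rightarrow> ('h \<Rightarrow> (nat \<Rightarrow> 'h)) \<Rightarrow> bool" where
  "unitary_to J l u \<longleftrightarrow> (\<forall>v. u v \<in> Hl l) \<and> u ` UNIV = Hl l \<and>
     (\<forall>a b v w. u (a *\<^sub>R v + b *\<^sub>R w) = (\<lambda>n. a *\<^sub>R u v n + b *\<^sub>R u w n)) \<and>
     (\<forall>v n. u (J v) n = J (u v n)) \<and>
     (\<forall>v. (\<Sum>n. (norm (u v n))\<^sup>2) = (norm v)\<^sup>2)"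

text \<open>Bounded invertible complex-linear s : H \<rightarrow> H^(2) = H \<times> H (bounded inverse expressed
  as a lower bound, together with bijectivity).\<close>
definition invertible2 :: "('h::real_normed_vector \<Rightarrow> 'h) \<Rightarrow> ('h \<Rightarrow> 'h \<times> 'h) \<Rightarrow> bool" where
  "invertible2 J s \<longleftrightarrow> bounded_linear s \<and> (\<forall>v. s (J v) = (J (fst (s v)), J (snd (s v)))) \<and>
     bij s \<and> (\<exists>C. \<forall>v. norm v \<le> C * norm (s v))"

definition nc_domain :: "('h::real_normed_vector \<Rightarrow> 'h) \<Rightarrow> (('h \<Rightarrow>\<^sub>L 'h) ^ 'd) set \<Rightarrow> bool" where
  "nc_domain J \<Omega> \<longleftrightarrow> \<Omega> \<subseteq> BHt J \<and>
    (\<exists>\<Omega>k :: nat \<Rightarrow> (('h \<Rightarrow>\<^sub>L 'h) ^ 'd) set.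
       (\<forall>k. \<Omega>k k \<subseteq> \<Omega>) \<and>
       (\<forall>k. \<Omega>k k \<subseteq> bint J (\<Omega>k (Suc k))) \<and> \<Omega> = (\<Union>k. \<Omega>k k) \<and>
       (\<forall>k. bounded (\<Omega>k k)) \<and>
       (\<forall>k. \<forall>x \<in> \<Omega>k k. \<forall>u. unitary_op J u \<longrightarrow>
           (\<exists>z \<in> \<Omega>k k. \<forall>i v. u (blinfun_apply (z $ i) v) = blinfun_apply (x $ i) (u v))) \<and>
       (\<forall>k. \<forall>l::enat. \<forall>x :: nat \<Rightarrow> ('h \<Rightarrow>\<^sub>L 'h) ^ 'd. 1 \<le> l \<longrightarrow>
           (\<forall>n. enat n < l \<longrightarrow> x n \<in> \<Omega>k k) \<longrightarrow>
           (\<exists>u z. unitary_to J l u \<and> z \<in> \<Omega>k k \<and>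
              (\<forall>i v n. enat n < l \<longrightarrow> u (blinfun_apply (z $ i) v) n = blinfun_apply (x n $ i) (u v n)))))"

text \<open>NC function: f (s^{-1} [x 0; 0 y] s) = s^{-1} [f x 0; 0 f y] s. The identity
  z = s^{-1} D s is expressed as s \<circ> z = D \<circ> s.\<close>
definition nc_function :: "('h::real_normed_vector \<Rightarrow> 'h) \<Rightarrow> (('h \<Rightarrow>\<^sub>L 'h) ^ 'd) set \<Rightarrow>
    (('h \<Rightarrow>\<^sub>L 'h) ^ 'd \<Rightarrow> ('h \<Rightarrow>\<^sub>L 'h) ^ 'r) \<Rightarrow> bool" where
  "nc_function J \<Omega> f \<longleftrightarrow> f ` \<Omega> \<subseteq> BHt J \<and>
    (\<forall>x \<in> \<Omega>. \<forall>y \<in> \<Omega>. \<forall>s z. invertible2 J s \<longrightarrow> z \<in> \<Omega> \<longrightarrow>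
       (\<forall>i v. s (blinfun_apply (z $ i) v) =
              (blinfun_apply (x $ i) (fst (s v)), blinfun_apply (y $ i) (snd (s v)))) \<longrightarrow>
       (\<forall>j v. s (blinfun_apply (f z $ j) v) =
              (blinfun_apply (f x $ j) (fst (s v)), blinfun_apply (f y $ j) (snd (s v)))))"

end

theory Submission
  imports Defs
begin

text \<open>
  Conjugating \<open>x \<oplus> y\<close> by the shear \<open>[1 c; 0 1]\<close> shows that \<open>f\<close> maps \<open>[x c(x - y); 0 y]\<close> to
  \<open>[f(x) c(f(x) - f(y)); 0 f(y)]\<close>. Together with boundedness of \<open>f\<close> on each piece of the
  exhaustion (an unbounded sequence of values would be compressions of the single operator
  \<open>f(\<Oplus> x\<^sub>n)\<close>) this makes \<open>f\<close> locally Lipschitz, and letting \<open>y\<close> tend to \<open>x\<close> it yields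
  differentiability and \<open>f([x h; 0 x]) = [f(x) Df(x)h; 0 f(x)]\<close> for small \<open>h\<close>.
  If \<open>Df(x)h = 0\<close>, then \<open>f\<close> identifies \<open>[x h; 0 x]\<close> with \<open>x \<oplus> x\<close>. Conversely, if
  \<open>f(a) = f(b)\<close>, then \<open>f\<close> is constant along \<open>c \<mapsto> [a c(a - b); 0 b]\<close>, so \<open>Df(a \<oplus> b)\<close> kills
  \<open>[0 a - b; 0 0]\<close>.
\<close>

section \<open>Block upper triangular tuples\<close>

text \<open>With inclusions and projections of a direct sum as \<open>A\<close> and
  \<open>B\<close>, this either places a tuple in one block of an operator matrix or cuts one block
  out. With the complex structure on both sides it gives \<open>J T J\<close>.\<close>

definition sandwich :: "('h::real_normed_vector \<Rightarrow>\<^sub>L 'h) \<Rightarrow> ('h \<Rightarrow>\<^sub>L 'h) \<Rightarrow> ('h \<Rightarrow>\<^sub>L 'h) ^ 'd \<Rightarrow> ('h \<Rightarrow>\<^sub>L 'h) ^ 'd" where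
  "sandwich A B x = (\<chi> i. A o\<^sub>L x $ i o\<^sub>L B)"

text \<open>The norm of a tuple is monotone in the norms of its entries, so comparing coordinates is
  enough.\<close>

lemma norm_sandwich_le:
  fixes x :: "('h::real_normed_vector \<Rightarrow>\<^sub>L 'h) ^ 'd"
  assumes "norm A \<le> 1" "norm B \<le> 1"
  shows "norm (sandwich A B x) \<le> norm x"
proof (rule norm_le_componentwise_cart)
  fix i
  have "norm (A o\<^sub>L x $ i o\<^sub>L B) \<le> norm A * norm (x $ i) * norm B"
    by (meson norm_blinfun_compose mult_right_mono norm_ge_zero order_trans)
  also have "\<dots> \<le> 1 * norm (x $ i) * 1"
    using assms by (intro mult_mono) auto
  finally show "norm (sandwich A B x $ i) \<le> norm (x $ i)"
    by (simp add: sandwich_def)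
qed

lemma linear_sandwich: "linear (sandwich A B)"
  by (rule linearI)
    (auto simp: sandwich_def vec_eq_iff blinfun.bilinear_simps intro!: blinfun_eqI)

lemma bounded_linear_sandwich:
  assumes "norm A \<le> 1" "norm B \<le> 1"
  shows "bounded_linear (sandwich A B :: ('h::real_normed_vector \<Rightarrow>\<^sub>L 'h) ^ 'd \<Rightarrow> _)"
  using norm_sandwich_le[OF assms]
  by (intro bounded_linear_intro[where K = 1] linear_add[OF linear_sandwich] linear_cmul[OF linear_sandwich])
    simp

lemma sandwich_BHt:
  assumes "A \<in> BH J" "B \<in> BH J" "x \<in> BHt J"
  shows "sandwich A B x \<in> BHt J"
  using assms by (simp add: sandwich_def BHt_def BH_def)

lemma subspace_BHt:
  assumes "linear J"
  shows "subspace (BHt J)"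
  using assms
  by (auto simp: subspace_def BHt_def BH_def blinfun.bilinear_simps linear_0 linear_add linear_cmul)

text \<open>Identities known only on a small ball reach every direction by this scaling. The
  \<open>+ 1\<close> in the witness covers \<open>g = 0\<close>.\<close>

lemma ex_small_scaleR:
  fixes g :: "'a::real_normed_vector"
  assumes "e > 0"
  shows "\<exists>a>0. norm (a *\<^sub>R g) < e"
proof (intro exI conjI)
  have pos: "norm g + 1 > 0" by (smt (verit) norm_ge_zero)
  then show "e / (norm g + 1) > 0" using assms by simp
  show "norm ((e / (norm g + 1)) *\<^sub>R g) < e" using assms pos by (simp add: field_simps)
qed

text \<open>A unitary \<open>H \<cong> H \<oplus> H\<close>, given by the inclusions \<open>E1, E2\<close> and the projections \<open>P1, P2\<close> of the
  two summands.\<close>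
locale block_frame =
  fixes J :: "'h::real_normed_vector \<Rightarrow> 'h" and E1 E2 P1 P2 :: "'h \<Rightarrow>\<^sub>L 'h"
  assumes P1E1: "P1 (E1 v) = v" and P2E2: "P2 (E2 v) = v"
    and P1E2: "P1 (E2 v) = 0" and P2E1: "P2 (E1 v) = 0"
    and decomp: "E1 (P1 v) + E2 (P2 v) = v"
    and norms: "norm E1 \<le> 1" "norm E2 \<le> 1" "norm P1 \<le> 1" "norm P2 \<le> 1"
    and comm: "E1 \<in> BH J" "E2 \<in> BH J" "P1 \<in> BH J" "P2 \<in> BH J"
    and lin: "linear J"
begin

lemmas frame_simps = P1E1 P2E2 P1E2 P2E1

text \<open>The operator matrix with rows \<open>a b\<close> and \<open>0 d\<close> on
  \<open>H \<oplus> H\<close>, carried back to \<open>H\<close> by the frame. In particular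
  \<open>UT x 0 y\<close> is the copy of \<open>x \<oplus> y\<close> acting on
  \<open>H\<close>.\<close>

definition UT :: "('h \<Rightarrow>\<^sub>L 'h) ^ 'd \<Rightarrow> ('h \<Rightarrow>\<^sub>L 'h) ^ 'd \<Rightarrow> ('h \<Rightarrow>\<^sub>L 'h) ^ 'd \<Rightarrow> ('h \<Rightarrow>\<^sub>L 'h) ^ 'd" where
  "UT a b d = sandwich E1 P1 a + sandwich E1 P2 b + sandwich E2 P2 d"

lemma UT_apply:
  "blinfun_apply (UT a b d $ i) v = E1 (blinfun_apply (a $ i) (P1 v)) + E1 (blinfun_apply (b $ i) (P2 v)) + E2 (blinfun_apply (d $ i) (P2 v))"
  by (simp add: UT_def sandwich_def blinfun.bilinear_simps)

lemma UT_diff: "UT a b d - UT a' b' d' = UT (a - a') (b - b') (d - d')"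
  by (simp add: UT_def linear_diff[OF linear_sandwich])

lemma norm_UT_le: "norm (UT a b d) \<le> norm a + norm b + norm d"
  unfolding UT_def
  by (intro order_trans[OF norm_triangle_ineq] add_mono norm_sandwich_le norms)

lemma corner_UT: "sandwich P1 E2 (UT a b d) = b"
  by (auto simp: sandwich_def vec_eq_iff UT_apply blinfun.bilinear_simps frame_simps intro!: blinfun_eqI)

lemma block11_UT: "sandwich P1 E1 (UT a b d) = a"
  by (auto simp: sandwich_def vec_eq_iff UT_apply blinfun.bilinear_simps frame_simps intro!: blinfun_eqI)

text \<open>Compression by contractions does not raise the norm. The corner of a value of
  \<open>f\<close> will hold a scaled difference of values, so bounds on \<open>f\<close> become
  bounds on differences.\<close>

lemma norm_corner_le: "norm b \<le> norm (UT a b d)"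
  using norm_sandwich_le[OF norms(3) norms(2), of "UT a b d"] by (simp add: corner_UT)

lemma norm_block11_le: "norm a \<le> norm (UT a b d)"
  using norm_sandwich_le[OF norms(3) norms(1), of "UT a b d"] by (simp add: block11_UT)

lemma UT_inject: "UT a b d = UT a b' d \<Longrightarrow> b = b'"
  by (metis corner_UT)

lemma UT_BHt:
  assumes "a \<in> BHt J" "b \<in> BHt J" "d \<in> BHt J"
  shows "UT a b d \<in> BHt J"
  unfolding UT_def using subspace_BHt[OF lin] assms comm
  by (intro subspace_add sandwich_BHt)

lemma UT_eqI:
  assumes "\<And>i v. P1 (blinfun_apply (z $ i) v) = blinfun_apply (a $ i) (P1 v) + blinfun_apply (b $ i) (P2 v)"
    and "\<And>i v. P2 (blinfun_apply (z $ i) v) = blinfun_apply (d $ i) (P2 v)"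
  shows "z = UT a b d"
proof -
  have "blinfun_apply (z $ i) v = blinfun_apply (UT a b d $ i) v" for i v
    using decomp[of "blinfun_apply (z $ i) v"] by (simp add: assms UT_apply blinfun.bilinear_simps)
  then show ?thesis by (simp add: vec_eq_iff blinfun_eqI)
qed

lemma tendsto_UT:
  assumes "(a \<longlongrightarrow> a0) F" "(b \<longlongrightarrow> b0) F" "(d \<longlongrightarrow> d0) F"
  shows "((\<lambda>t. UT (a t) (b t) (d t)) \<longlongrightarrow> UT a0 b0 d0) F"
  unfolding UT_def
  by (intro tendsto_add bounded_linear.tendsto[OF bounded_linear_sandwich] norms assms)

text \<open>The shear \<open>[1 c; 0 1]\<close> composed with the frame conjugates
  \<open>x \<oplus> y\<close> to the matrix with corner \<open>c (x - y)\<close>. The value of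
  \<open>f\<close> there satisfies the same intertwining relation with \<open>f x\<close> and
  \<open>f y\<close>, hence has the same shape.\<close>

lemma nc_function_UT:
  fixes f :: "('h \<Rightarrow>\<^sub>L 'h) ^ 'd \<Rightarrow> ('h \<Rightarrow>\<^sub>L 'h) ^ 'r"
  assumes f: "nc_function J \<Omega> f" and xy: "x \<in> \<Omega>" "y \<in> \<Omega>"
    and z: "UT x (c *\<^sub>R (x - y)) y \<in> \<Omega>"
  shows "f (UT x (c *\<^sub>R (x - y)) y) = UT (f x) (c *\<^sub>R (f x - f y)) (f y)"
proof -
  define s where "s v = (P1 v + c *\<^sub>R P2 v, P2 v)" for v
  \<comment> \<open>The inverse of \<open>s\<close>: undo the shear, then reassemble the summands.
    Its boundedness supplies the lower bound in \<open>invertible2\<close>.\<close>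
  define t where "t p = E1 (fst p - c *\<^sub>R snd p) + E2 (snd p)" for p
  have ts: "t (s v) = v" for v using decomp by (simp add: t_def s_def)
  have st: "s (t p) = p" for p
    by (simp add: t_def s_def blinfun.bilinear_simps frame_simps)
  have bij: "bij s" using ts st by (intro o_bij[of t]) (auto simp: fun_eq_iff)
  have bl: "bounded_linear s"
    unfolding s_def
    by (intro bounded_linear_Pair bounded_linear_add bounded_linear_compose[OF bounded_linear_scaleR_right]
        blinfun.bounded_linear_right)
  have blt: "bounded_linear t"
    unfolding t_def
    by (intro bounded_linear_add bounded_linear_sub bounded_linear_compose[OF blinfun.bounded_linear_right]
        bounded_linear_compose[OF bounded_linear_scaleR_right] bounded_linear_fst bounded_linear_snd)
  then obtain C where "\<And>p. norm (t p) \<le> norm p * C" using bounded_linear.bounded by blast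
  then have C: "norm v \<le> C * norm (s v)" for v by (metis ts mult.commute)
  have "s (J v) = (J (fst (s v)), J (snd (s v)))" for v
    using comm by (simp add: s_def BH_def linear_add[OF lin] linear_cmul[OF lin])
  then have inv: "invertible2 J s" using bij bl C by (auto simp: invertible2_def)
  let ?z = "UT x (c *\<^sub>R (x - y)) y"
  have "s (blinfun_apply (?z $ i) v) = (blinfun_apply (x $ i) (fst (s v)), blinfun_apply (y $ i) (snd (s v)))" for i v
    by (simp add: s_def UT_apply blinfun.bilinear_simps frame_simps algebra_simps)
  then have *: "s (blinfun_apply (f ?z $ j) v) = (blinfun_apply (f x $ j) (fst (s v)), blinfun_apply (f y $ j) (snd (s v)))" for j v
    using f xy z inv unfolding nc_function_def by blast
  show ?thesis
  proof (rule UT_eqI)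
    fix i v
    \<comment> \<open>The two coordinates of the intertwining identity; inserting \<open>2\<close>
      into \<open>1\<close> solves for the corner.\<close>
    have 1: "P1 (blinfun_apply (f ?z $ i) v) + c *\<^sub>R P2 (blinfun_apply (f ?z $ i) v) = blinfun_apply (f x $ i) (P1 v + c *\<^sub>R P2 v)"
      and 2: "P2 (blinfun_apply (f ?z $ i) v) = blinfun_apply (f y $ i) (P2 v)"
      using *[of i v] by (auto simp: s_def)
    show "P2 (blinfun_apply (f ?z $ i) v) = blinfun_apply (f y $ i) (P2 v)" by (fact 2)
    show "P1 (blinfun_apply (f ?z $ i) v) = blinfun_apply (f x $ i) (P1 v) + blinfun_apply ((c *\<^sub>R (f x - f y)) $ i) (P2 v)"
      using 1 2 by (simp add: blinfun.bilinear_simps algebra_simps)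
  qed
qed

end

text \<open>The inverse of \<open>s\<close> on each summand gives the inclusions, the coordinates of
  \<open>s\<close> give the projections. Isometry makes all four contractive, and commutation with
  \<open>J\<close> passes to the inverse.\<close>

lemma block_frame_of_isometry:
  fixes s :: "'h::real_normed_vector \<Rightarrow> 'h \<times> 'h"
  assumes s: "linear s" "surj s" and iso: "\<And>v. norm (s v) = norm v" and J: "linear J"
    and sJ: "\<And>v. s (J v) = (J (fst (s v)), J (snd (s v)))"
  obtains E1 E2 P1 P2 where "block_frame J E1 E2 P1 P2"
    and "\<And>v. P1 v = fst (s v)" and "\<And>v. P2 v = snd (s v)"
proof -
  have "inj s" unfolding linear_injective_0[OF s(1)] by (metis iso norm_eq_zero)
  then have bij: "bij s" using s(2) by (simp add: bij_def)
  define t where "t = inv s"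
  have ts: "t (s v) = v" and st: "s (t p) = p" for v p
    using bij by (auto simp: t_def bij_def surj_f_inv_f)
  have t_add: "t (p + q) = t p + t q" for p q
    by (metis st ts linear_add[OF s(1)])
  have t_scale: "t (c *\<^sub>R p) = c *\<^sub>R t p" for c p
    by (metis st ts linear_cmul[OF s(1)])
  have t_norm: "norm (t p) = norm p" for p by (metis iso st)
  have tJ: "t (J a, J b) = J (t (a, b))" for a b
    by (metis st ts sJ fst_conv snd_conv)
  have n1: "norm (fst (s v)) \<le> norm v" and n2: "norm (snd (s v)) \<le> norm v" for v
    by (metis iso norm_fst_le prod.collapse, metis iso norm_snd_le prod.collapse)
  have e1: "bounded_linear (\<lambda>a. t (a, 0))"
    by (rule bounded_linear_intro[where K = 1])
      (auto simp: t_norm norm_Pair simp flip: t_add t_scale)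
  have e2: "bounded_linear (\<lambda>a. t (0, a))"
    by (rule bounded_linear_intro[where K = 1])
      (auto simp: t_norm norm_Pair simp flip: t_add t_scale)
  have p1: "bounded_linear (\<lambda>v. fst (s v))"
    by (rule bounded_linear_intro[where K = 1])
      (auto simp: linear_add[OF s(1)] linear_cmul[OF s(1)] n1)
  have p2: "bounded_linear (\<lambda>v. snd (s v))"
    by (rule bounded_linear_intro[where K = 1])
      (auto simp: linear_add[OF s(1)] linear_cmul[OF s(1)] n2)
  note A = bounded_linear_Blinfun_apply[OF e1] bounded_linear_Blinfun_apply[OF e2]
    bounded_linear_Blinfun_apply[OF p1] bounded_linear_Blinfun_apply[OF p2]
  have "block_frame J (Blinfun (\<lambda>a. t (a, 0))) (Blinfun (\<lambda>a. t (0, a)))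
      (Blinfun (\<lambda>v. fst (s v))) (Blinfun (\<lambda>v. snd (s v)))"
  proof
    fix v
    show "Blinfun (\<lambda>a. t (a, 0)) (Blinfun (\<lambda>v. fst (s v)) v)
        + Blinfun (\<lambda>a. t (0, a)) (Blinfun (\<lambda>v. snd (s v)) v) = v"
      by (simp add: A ts flip: t_add)
  qed (auto simp: linear_add[OF J] linear_cmul[OF J] A st BH_def sJ J t_norm norm_Pair linear_0 tJ[symmetric] linear_0[OF J]
      n1 n2 intro!: norm_blinfun_bound)
  then show thesis by (rule that) (simp_all add: A)
qed

section \<open>Direct sums inside the domain\<close>

text \<open>The direct sum condition of \<open>nc_domain\<close> for a single piece of the
  exhaustion. It will be applied with \<open>l = 2\<close> and
  \<open>l = \<infinity>\<close>.\<close>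

definition sum_closed :: "('h::real_normed_vector \<Rightarrow> 'h) \<Rightarrow> (('h \<Rightarrow>\<^sub>L 'h) ^ 'd) set \<Rightarrow> bool" where
  "sum_closed J X \<longleftrightarrow> (\<forall>l::enat. \<forall>x :: nat \<Rightarrow> ('h \<Rightarrow>\<^sub>L 'h) ^ 'd. 1 \<le> l \<longrightarrow>
     (\<forall>n. enat n < l \<longrightarrow> x n \<in> X) \<longrightarrow>
     (\<exists>u z. unitary_to J l u \<and> z \<in> X \<and>
        (\<forall>i v n. enat n < l \<longrightarrow> u (blinfun_apply (z $ i) v) n = blinfun_apply (x n $ i) (u v n))))"

section \<open>Coordinates of a unitary onto a direct sum\<close>

lemma unitary_to_add:
  assumes "unitary_to J l u" shows "u (v + w) n = u v n + u w n"
proof -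
  have "u (1 *\<^sub>R v + 1 *\<^sub>R w) = (\<lambda>n. 1 *\<^sub>R u v n + 1 *\<^sub>R u w n)"
    using assms unfolding unitary_to_def by blast
  then show ?thesis by simp
qed

lemma unitary_to_scaleR:
  assumes "unitary_to J l u" shows "u (c *\<^sub>R v) n = c *\<^sub>R u v n"
proof -
  have "u (c *\<^sub>R v + 0 *\<^sub>R v) = (\<lambda>n. c *\<^sub>R u v n + 0 *\<^sub>R u v n)"
    using assms unfolding unitary_to_def by blast
  then show ?thesis by simp
qed

lemma unitary_to_sums:
  assumes "unitary_to J l u" shows "(\<lambda>n. (norm (u v n))\<^sup>2) sums (norm v)\<^sup>2"
  using assms by (simp add: unitary_to_def Hl_def sums_iff)

lemma unitary_to_surj:
  assumes "unitary_to J l u" "w \<in> Hl l" obtains v where "u v = w"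
proof -
  have "w \<in> range u" using assms by (simp add: unitary_to_def)
  then show thesis using that by blast
qed

lemma unitary_to_inj:
  assumes "unitary_to J l u" shows "inj u"
proof (rule injI)
  fix v w assume *: "u v = u w"
  have "u (v - w) n = 0" for n
    using unitary_to_add[OF assms, of "v - w" w n] * by simp
  then have "(norm (v - w))\<^sup>2 = 0"
    using unitary_to_sums[OF assms, of "v - w"] sums_unique2[OF sums_zero] by fastforce
  then show "v = w" by simp
qed

text \<open>Coordinates 0 and 1 of the unitary for a sequence of length two form an isometry onto
  \<open>H \<times> H\<close>, which yields the frame.\<close>

lemma sum_closed_pair:
  fixes X :: "(('h::real_normed_vector \<Rightarrow>\<^sub>L 'h) ^ 'd) set"
  assumes X: "sum_closed J X" and J: "linear J" and xy: "x \<in> X" "y \<in> X"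
  obtains E1 E2 P1 P2 where "block_frame J E1 E2 P1 P2" "block_frame.UT E1 E2 P1 P2 x 0 y \<in> X"
proof -
  have "\<exists>u z. unitary_to J (enat 2) u \<and> z \<in> X \<and>
     (\<forall>i v n. enat n < enat 2 \<longrightarrow>
        u (blinfun_apply (z $ i) v) n = blinfun_apply ((if n = 0 then x else y) $ i) (u v n))"
    using xy by (intro X[unfolded sum_closed_def, rule_format]) (auto simp: one_enat_def)
  then obtain u z where u: "unitary_to J (enat 2) u" and z: "z \<in> X"
    and zu: "\<And>i v n. n < 2 \<Longrightarrow>
        u (blinfun_apply (z $ i) v) n = blinfun_apply ((if n = 0 then x else y) $ i) (u v n)"
    by auto
  define s where "s v = (u v 0, u v 1)" for v
  have lin: "linear s"
    by (rule linearI) (simp_all add: s_def unitary_to_add[OF u] unitary_to_scaleR[OF u])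
  have iso: "norm (s v) = norm v" for v
  proof -
    have "u v \<in> Hl (enat 2)" using u unfolding unitary_to_def by blast
    then have "\<forall>n. n \<notin> {..<2} \<longrightarrow> u v n = 0" by (simp add: Hl_def)
    then have "(\<lambda>n. (norm (u v n))\<^sup>2) sums (\<Sum>n<2. (norm (u v n))\<^sup>2)"
      by (intro sums_finite) auto
    then have "(\<Sum>n<2. (norm (u v n))\<^sup>2) = (norm v)\<^sup>2"
      using unitary_to_sums[OF u] sums_unique2 by blast
    then show ?thesis by (simp add: s_def norm_Pair numeral_2_eq_2)
  qed
  have "\<exists>v. s v = (a, b)" for a b
  proof -
    define w where "w n = (if n = 0 then a else if n = 1 then b else 0)" for n :: nat
    have "summable (\<lambda>n. (norm (w n))\<^sup>2)"
      by (rule summable_finite[of "{..<2}"]) (auto simp: w_def)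
    then have "w \<in> Hl (enat 2)" by (auto simp: Hl_def w_def)
    then obtain v where v: "u v = w" by (rule unitary_to_surj[OF u])
    have "s v = (a, b)" by (simp add: s_def v w_def)
    then show ?thesis by blast
  qed
  then have surj: "surj s" unfolding surj_def by (metis surj_pair)
  have sJ: "s (J v) = (J (fst (s v)), J (snd (s v)))" for v
    using u unfolding unitary_to_def s_def by simp
  obtain E1 E2 P1 P2 where fr: "block_frame J E1 E2 P1 P2"
    and P: "\<And>v. P1 v = fst (s v)" "\<And>v. P2 v = snd (s v)"
    using block_frame_of_isometry[OF lin surj iso J sJ] by blast
  have "z = block_frame.UT E1 E2 P1 P2 x 0 y"
    by (rule block_frame.UT_eqI[OF fr]) (simp_all add: P s_def zu)
  then show thesis using that fr z by blast
qed

text \<open>One direct sum \<open>z\<close> of the whole sequence serves all \<open>n\<close>. The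
  complement of \<open>x n\<close> in \<open>z\<close> must again lie in \<open>X\<close> for the NC
  identity to apply, so it is realised as a direct sum \<open>y\<close> of the remaining terms, and
  the two unitaries are glued.\<close>

lemma sum_closed_seq:
  fixes X :: "(('h::real_normed_vector \<Rightarrow>\<^sub>L 'h) ^ 'd) set" and x :: "nat \<Rightarrow> ('h \<Rightarrow>\<^sub>L 'h) ^ 'd"
  assumes X: "sum_closed J X" and J: "linear J" and x: "\<And>n. x n \<in> X"
  shows "\<exists>z \<in> X. \<forall>n. \<exists>y \<in> X. \<exists>E1 E2 P1 P2.
    block_frame J E1 E2 P1 P2 \<and> z = block_frame.UT E1 E2 P1 P2 (x n) 0 y"
proof -
  have ex: "\<exists>u z. unitary_to J \<infinity> u \<and> z \<in> X \<and>
     (\<forall>i v n. u (blinfun_apply (z $ i) v) n = blinfun_apply (x' n $ i) (u v n))"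
    if "\<And>n. x' n \<in> X" for x'
    using X[unfolded sum_closed_def, rule_format, of \<infinity> x'] that by auto
  obtain u z where u: "unitary_to J \<infinity> u" and z: "z \<in> X"
    and zu: "\<And>i v n. u (blinfun_apply (z $ i) v) n = blinfun_apply (x n $ i) (u v n)"
    using ex[of x] x by blast
  have "\<exists>y \<in> X. \<exists>E1 E2 P1 P2. block_frame J E1 E2 P1 P2 \<and> z = block_frame.UT E1 E2 P1 P2 (x n) 0 y" for n
  proof -
    text \<open>\<open>g\<close> enumerates the indices other than \<open>n\<close>: \<open>z\<close> splits as \<open>x n\<close> plus the direct sum \<open>y\<close> of the rest.\<close>
    define g where "g m = (if m < n then m else Suc m)" for m
    have g: "strict_mono g" by (auto simp: g_def strict_mono_def)
    have range_g: "m \<in> range g" if "m \<noteq> n" for m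
      using that by (intro image_eqI[of _ _ "if m < n then m else m - 1"]) (auto simp: g_def)
    \<comment> \<open>\<open>b\<close> is \<open>a\<close> with its \<open>n\<close>-th term set to
      zero; it vanishes off the range of \<open>g\<close>, so reindexing by \<open>g\<close> keeps
      its sum.\<close>
    have split: "a sums (S + a n) \<longleftrightarrow> (\<lambda>m. a (g m)) sums S" for a :: "nat \<Rightarrow> real" and S
    proof -
      define b where "b m = (if m = n then 0 else a m)" for m
      have "(\<lambda>m. a (g m)) = (\<lambda>m. b (g m))" by (auto simp: b_def g_def)
      then have "(\<lambda>m. a (g m)) sums S \<longleftrightarrow> b sums S"
        using sums_mono_reindex[OF g, of b S] range_g by (metis b_def)
      also have "\<dots> \<longleftrightarrow> a sums (S + a n)"
      proof -
        have s: "(\<lambda>m. if m = n then a m else 0) sums a n" by (rule sums_single)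
        show ?thesis
        proof
          assume "b sums S"
          from sums_add[OF this s] show "a sums (S + a n)"
            by (rule back_subst[of "\<lambda>f. f sums (S + a n)"]) (auto simp: b_def)
        next
          assume "a sums (S + a n)"
          from sums_diff[OF this s] show "b sums S"
            by (auto elim!: back_subst[of "\<lambda>f. f sums S"] simp: b_def)
        qed
      qed
      finally show ?thesis by simp
    qed
    obtain v y where v: "unitary_to J \<infinity> v" and y: "y \<in> X"
      and yv: "\<And>i \<xi> m. v (blinfun_apply (y $ i) \<xi>) m = blinfun_apply (x (g m) $ i) (v \<xi> m)"
      using ex[of "\<lambda>m. x (g m)"] x by blast
    \<comment> \<open>The component of \<open>\<xi>\<close> outside slot \<open>n\<close>: its
      coordinates under \<open>u\<close> are renumbered by \<open>g\<close> and reassembled by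
      \<open>v\<close>.\<close>
    define r where "r \<xi> = inv v (\<lambda>m. u \<xi> (g m))" for \<xi>
    have rest: "(\<lambda>m. (norm (u \<xi> (g m)))\<^sup>2) sums ((norm \<xi>)\<^sup>2 - (norm (u \<xi> n))\<^sup>2)" for \<xi>
      using unitary_to_sums[OF u, of \<xi>] by (simp flip: split[of "\<lambda>m. (norm (u \<xi> m))\<^sup>2"])
    have vr: "v (r \<xi>) = (\<lambda>m. u \<xi> (g m))" for \<xi>
    proof -
      have "(\<lambda>m. u \<xi> (g m)) \<in> Hl \<infinity>"
        using rest[of \<xi>] by (auto simp: Hl_def sums_iff)
      then have "(\<lambda>m. u \<xi> (g m)) \<in> range v" using v unfolding unitary_to_def by simp
      then show ?thesis unfolding r_def by (rule f_inv_into_f)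
    qed
    have r_eqI: "r \<xi> = \<eta>" if "\<And>m. u \<xi> (g m) = v \<eta> m" for \<xi> \<eta>
      using that unitary_to_inj[OF v] vr[of \<xi>] by (auto simp: inj_def fun_eq_iff)
    define s where "s \<xi> = (u \<xi> n, r \<xi>)" for \<xi>
    have "r (a + b) = r a + r b" for a b
      by (rule r_eqI) (simp add: unitary_to_add[OF u] unitary_to_add[OF v] vr)
    moreover have "r (c *\<^sub>R a) = c *\<^sub>R r a" for c a
      by (rule r_eqI) (simp add: unitary_to_scaleR[OF u] unitary_to_scaleR[OF v] vr)
    ultimately have lin: "linear s"
      by (intro linearI) (simp_all add: s_def unitary_to_add[OF u] unitary_to_scaleR[OF u])
    have iso: "norm (s \<xi>) = norm \<xi>" for \<xi>
    proof -
      have "(norm (r \<xi>))\<^sup>2 = (norm \<xi>)\<^sup>2 - (norm (u \<xi> n))\<^sup>2"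
        using unitary_to_sums[OF v, of "r \<xi>"] rest[of \<xi>] sums_unique2 by (simp add: vr) blast
      then show ?thesis by (simp add: s_def norm_Pair)
    qed
    have "\<exists>\<xi>. s \<xi> = (a, \<eta>)" for a \<eta>
    proof -
      \<comment> \<open>The coordinates of the preimage: \<open>a\<close> goes into slot
        \<open>n\<close> and those of \<open>\<eta>\<close> fill the others. The index
        \<open>m - 1\<close> inverts \<open>g\<close> beyond \<open>n\<close>.\<close>
      define w where "w m = (if m = n then a else v \<eta> (if m < n then m else m - 1))" for m
      have wg: "w (g m) = v \<eta> m" for m by (auto simp: w_def g_def)
      have "(\<lambda>m. (norm (w m))\<^sup>2) sums ((norm \<eta>)\<^sup>2 + (norm (w n))\<^sup>2)"
        unfolding split[of "\<lambda>m. (norm (w m))\<^sup>2"] wg by (rule unitary_to_sums[OF v])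
      then have "w \<in> Hl \<infinity>" by (auto simp: Hl_def sums_iff)
      then obtain \<xi> where "u \<xi> = w" by (rule unitary_to_surj[OF u])
      then have "s \<xi> = (a, \<eta>)" using r_eqI[of \<xi> \<eta>] wg by (simp add: s_def) (simp add: w_def)
      then show ?thesis by blast
    qed
    then have surj: "surj s" unfolding surj_def by (metis surj_pair)
    have uJ: "u (J \<xi>) m = J (u \<xi> m)" and vJ: "v (J \<xi>) m = J (v \<xi> m)" for \<xi> m
      using u v unfolding unitary_to_def by blast+
    have "r (J \<xi>) = J (r \<xi>)" for \<xi>
      by (rule r_eqI) (simp add: uJ vJ vr)
    then have sJ: "s (J \<xi>) = (J (fst (s \<xi>)), J (snd (s \<xi>)))" for \<xi>
      by (simp add: s_def uJ)
    obtain E1 E2 P1 P2 where fr: "block_frame J E1 E2 P1 P2"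
      and P: "\<And>\<xi>. P1 \<xi> = fst (s \<xi>)" "\<And>\<xi>. P2 \<xi> = snd (s \<xi>)"
      using block_frame_of_isometry[OF lin surj iso J sJ] by blast
    have rz: "r (blinfun_apply (z $ i) \<xi>) = blinfun_apply (y $ i) (r \<xi>)" for i \<xi>
      by (rule r_eqI) (simp add: zu yv vr)
    have "z = block_frame.UT E1 E2 P1 P2 (x n) 0 y"
      by (rule block_frame.UT_eqI[OF fr]) (simp_all add: P s_def zu rz)
    then show ?thesis using fr y by blast
  qed
  with z show ?thesis by blast
qed

text \<open>If the values were unbounded, some sequence would satisfy
  \<open>n < norm (f (x n))\<close>. Its direct sum \<open>z\<close> has each \<open>f (x n)\<close>
  as a diagonal block of \<open>f z\<close>, so \<open>norm (f z)\<close> would exceed every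
  \<open>n\<close>.\<close>

lemma nc_function_bounded:
  fixes f :: "('h::real_normed_vector \<Rightarrow>\<^sub>L 'h) ^ 'd \<Rightarrow> ('h \<Rightarrow>\<^sub>L 'h) ^ 'r"
  assumes X: "sum_closed J X" and J: "linear J" and f: "nc_function J \<Omega> f" and sub: "X \<subseteq> \<Omega>"
  shows "\<exists>M. \<forall>x \<in> X. norm (f x) \<le> M"
proof (rule ccontr)
  assume "\<not> ?thesis"
  then have "\<forall>n. \<exists>x. x \<in> X \<and> real n < norm (f x)" by (simp add: not_le Bex_def)
  then obtain x where "\<forall>n. x n \<in> X \<and> real n < norm (f (x n))" by (rule choice[THEN exE])
  then have x: "x n \<in> X" and big: "real n < norm (f (x n))" for n by blast+
  obtain z where z: "z \<in> X"
    and split: "\<forall>n. \<exists>y \<in> X. \<exists>E1 E2 P1 P2.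
      block_frame J E1 E2 P1 P2 \<and> z = block_frame.UT E1 E2 P1 P2 (x n) 0 y"
    using sum_closed_seq[where x = x, OF X J x] by blast
  have "norm (f (x n)) \<le> norm (f z)" for n
  proof -
    obtain y E1 E2 P1 P2 where y: "y \<in> X" and fr: "block_frame J E1 E2 P1 P2"
      and zeq: "z = block_frame.UT E1 E2 P1 P2 (x n) 0 y"
      using split by blast
    interpret block_frame J E1 E2 P1 P2 by (fact fr)
    \<comment> \<open>The shear parameter \<open>0\<close> gives compatibility of \<open>f\<close>
      with direct sums.\<close>
    have "f z = UT (f (x n)) 0 (f y)"
      using nc_function_UT[OF f, of "x n" y 0] x y z sub zeq by auto
    then show ?thesis using norm_block11_le by metis
  qed
  then have "real n < norm (f z)" for n using big less_le_trans by blast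
  then show False using reals_Archimedean2 order_less_asym by blast
qed

section \<open>Differentiability\<close>

text \<open>What the rest of the argument takes from an NC domain: relative openness of
  \<open>\<Omega>\<close> in \<open>BHt J\<close> with local boundedness of \<open>f\<close>, and
  direct sums of two points. The frame may depend on the pair.\<close>

locale nc_local =
  fixes J :: "'h::{real_inner,complete_space} \<Rightarrow> 'h"
    and \<Omega> :: "(('h \<Rightarrow>\<^sub>L 'h) ^ 'd) set"
    and f :: "('h \<Rightarrow>\<^sub>L 'h) ^ 'd \<Rightarrow> ('h \<Rightarrow>\<^sub>L 'h) ^ 'r"
  assumes J: "complex_structure J"
    and nc: "nc_function J \<Omega> f"
    and sub: "\<Omega> \<subseteq> BHt J"
    and locally_bounded: "p \<in> \<Omega> \<Longrightarrow> \<exists>e>0. \<exists>M. \<forall>y\<in>BHt J. norm (y - p) < e \<longrightarrow> y \<in> \<Omega> \<and> norm (f y) \<le> M"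
    and frame: "x \<in> \<Omega> \<Longrightarrow> y \<in> \<Omega> \<Longrightarrow> \<exists>E1 E2 P1 P2. block_frame J E1 E2 P1 P2 \<and> block_frame.UT E1 E2 P1 P2 x 0 y \<in> \<Omega>"
begin

lemma linear_J: "linear J"
  using J by (simp add: complex_structure_def)

lemmas sub_BHt = subspace_BHt[OF linear_J]

text \<open>A bound \<open>M\<close> on \<open>f\<close> near \<open>p \<oplus> p\<close> suffices:
  a multiple of \<open>y - y'\<close> of fixed size is put in the corner, and the same multiple of
  \<open>f y - f y'\<close> then has norm at most \<open>M\<close>.\<close>

lemma locally_lipschitz:
  assumes p: "p \<in> \<Omega>"
  shows "\<exists>e>0. \<exists>K\<ge>0. \<forall>y\<in>BHt J. \<forall>y'\<in>BHt J. norm (y - p) < e \<longrightarrow> norm (y' - p) < e \<longrightarrow>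
    y \<in> \<Omega> \<and> norm (f y - f y') \<le> K * norm (y - y')"
proof -
  obtain E1 E2 P1 P2 where fr: "block_frame J E1 E2 P1 P2"
    and q: "block_frame.UT E1 E2 P1 P2 p 0 p \<in> \<Omega>"
    using frame[OF p p] by blast
  interpret block_frame J E1 E2 P1 P2 by (fact fr)
  obtain e1 M1 where e1: "e1 > 0" and ball1: "\<And>y. y \<in> BHt J \<Longrightarrow> norm (y - p) < e1 \<Longrightarrow> y \<in> \<Omega>"
    using locally_bounded[OF p] by blast
  obtain e2 M where e2: "e2 > 0"
    and ball2: "\<And>y. y \<in> BHt J \<Longrightarrow> norm (y - UT p 0 p) < e2 \<Longrightarrow> y \<in> \<Omega> \<and> norm (f y) \<le> M"
    using locally_bounded[OF q] by blast
  have M: "M \<ge> 0" using ball2[of "UT p 0 p"] q sub e2 by (auto intro: order_trans[OF norm_ge_zero])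
  \<comment> \<open>The two diagonal blocks deviate by less than \<open>e2 / 4\<close> and the
    corner has norm \<open>e2 / 4\<close>, so the matrix stays within \<open>e2\<close> of
    \<open>UT p 0 p\<close>.\<close>
  define e where "e = min e1 (e2 / 4)"
  have "norm (f y - f y') \<le> 4 * M / e2 * norm (y - y')"
    if y: "y \<in> BHt J" "y' \<in> BHt J" and near: "norm (y - p) < e" "norm (y' - p) < e" for y y'
  proof (cases "y = y'")
    case False
    define c where "c = e2 / (4 * norm (y - y'))"
    have c: "c > 0" using e2 False by (simp add: c_def)
    have cn: "norm (c *\<^sub>R (y - y')) = e2 / 4" using False e2 by (simp add: c_def)
    have yO: "y \<in> \<Omega>" "y' \<in> \<Omega>" using ball1 y near by (auto simp: e_def)
    let ?z = "UT y (c *\<^sub>R (y - y')) y'"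
    have zB: "?z \<in> BHt J"
      using y sub_BHt by (intro UT_BHt subspace_mul subspace_diff)
    have "norm (?z - UT p 0 p) \<le> norm (y - p) + norm (c *\<^sub>R (y - y')) + norm (y' - p)"
      using norm_UT_le[of "y - p" "c *\<^sub>R (y - y')" "y' - p"] by (simp add: UT_diff)
    also have "\<dots> < e2" using near cn e2 by (simp add: e_def)
    finally have z: "?z \<in> \<Omega>" "norm (f ?z) \<le> M" using ball2[OF zB] by auto
    have "norm (c *\<^sub>R (f y - f y')) \<le> norm (f ?z)"
      unfolding nc_function_UT[OF nc yO z(1)] by (rule norm_corner_le)
    then have "c * norm (f y - f y') \<le> M" using z(2) c by simp
    then have "norm (f y - f y') \<le> M / c" using c by (simp add: field_simps)
    then show ?thesis using False by (simp add: c_def field_simps)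
  qed simp
  moreover have "e > 0" "4 * M / e2 \<ge> 0" using e1 e2 M by (auto simp: e_def)
  moreover have "y \<in> \<Omega>" if "y \<in> BHt J" "norm (y - p) < e" for y
    using ball1 that by (simp add: e_def)
  ultimately show ?thesis by (intro exI[of _ e] exI[of _ "4 * M / e2"] conjI ballI impI) simp_all
qed

text \<open>\<open>l h\<close> is the corner of \<open>f (UT x h x)\<close>, the future derivative,
  known so far only for small \<open>h\<close>. Replacing the diagonal entries \<open>y\<close>,
  \<open>y'\<close> by \<open>x\<close> moves the value of \<open>f\<close> by a Lipschitz amount,
  which gives the last estimate. Two free points are allowed because additivity of the derivative
  needs a moving base point.\<close>

lemma UT_limit:
  assumes fr: "block_frame J E1 E2 P1 P2" and x: "x \<in> \<Omega>"
    and p: "block_frame.UT E1 E2 P1 P2 x 0 x \<in> \<Omega>"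
  obtains e K l where "e > 0" "K \<ge> 0"
    and "\<And>y. y \<in> BHt J \<Longrightarrow> norm (y - x) < e \<Longrightarrow> y \<in> \<Omega>"
    and "\<And>h. h \<in> BHt J \<Longrightarrow> norm h < e \<Longrightarrow> block_frame.UT E1 E2 P1 P2 x h x \<in> \<Omega>"
    and "\<And>h. h \<in> BHt J \<Longrightarrow> norm h < e \<Longrightarrow>
      f (block_frame.UT E1 E2 P1 P2 x h x) = block_frame.UT E1 E2 P1 P2 (f x) (l h) (f x)"
    and "\<And>y y' c. y \<in> BHt J \<Longrightarrow> y' \<in> BHt J \<Longrightarrow> norm (y - x) < e \<Longrightarrow> norm (y' - x) < e \<Longrightarrow>
      norm (c *\<^sub>R (y - y')) < e \<Longrightarrow>
      norm (c *\<^sub>R (f y - f y') - l (c *\<^sub>R (y - y'))) \<le> K * (norm (y - x) + norm (y' - x))"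
proof -
  interpret block_frame J E1 E2 P1 P2 by (fact fr)
  obtain e1 M1 where e1: "e1 > 0" and ball1: "\<And>y. y \<in> BHt J \<Longrightarrow> norm (y - x) < e1 \<Longrightarrow> y \<in> \<Omega>"
    using locally_bounded[OF x] by blast
  obtain e2 K where e2: "e2 > 0" and K: "K \<ge> 0"
    and lip: "\<And>y y'. \<lbrakk>y \<in> BHt J; y' \<in> BHt J; norm (y - UT x 0 x) < e2; norm (y' - UT x 0 x) < e2\<rbrakk> \<Longrightarrow>
      y \<in> \<Omega> \<and> norm (f y - f y') \<le> K * norm (y - y')"
    using locally_lipschitz[OF p] by meson
  define e where "e = min e1 (e2 / 3)"
  have e: "e > 0" using e1 e2 by (simp add: e_def)
  have xB: "x \<in> BHt J" using x sub by blast
  have ball: "y \<in> \<Omega>" if "y \<in> BHt J" "norm (y - x) < e" for y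
    using ball1 that by (simp add: e_def)
  have near: "norm (UT y h y' - UT x 0 x) < e2"
    if "norm (y - x) < e" "norm (y' - x) < e" "norm h < e" for y y' h
    using norm_UT_le[of "y - x" h "y' - x"] that by (simp add: UT_diff e_def)
  have in_Omega: "UT y h y' \<in> \<Omega>"
    if "y \<in> BHt J" "y' \<in> BHt J" "h \<in> BHt J" "norm (y - x) < e" "norm (y' - x) < e" "norm h < e" for y y' h
    using that lip[OF UT_BHt UT_BHt near near, of y h y' y h y'] by simp
  have close: "norm (f (UT y h y') - f (UT x h x)) \<le> K * (norm (y - x) + norm (y' - x))"
    if "y \<in> BHt J" "y' \<in> BHt J" "h \<in> BHt J" "norm (y - x) < e" "norm (y' - x) < e" "norm h < e" for y y' h
  proof -
    have "norm (f (UT y h y') - f (UT x h x)) \<le> K * norm (UT y h y' - UT x h x)"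
      using that e xB by (intro lip[THEN conjunct2] near UT_BHt) auto
    also have "\<dots> \<le> K * (norm (y - x) + norm (y' - x))"
      using norm_UT_le[of "y - x" 0 "y' - x"] K by (intro mult_left_mono) (auto simp: UT_diff)
    finally show ?thesis .
  qed
  define l where "l h = sandwich P1 E2 (f (UT x h x))" for h
  have quot: "norm (c *\<^sub>R (f y - f y') - l (c *\<^sub>R (y - y'))) \<le> K * (norm (y - x) + norm (y' - x))"
    if y: "y \<in> BHt J" "y' \<in> BHt J" "norm (y - x) < e" "norm (y' - x) < e"
      and h: "norm (c *\<^sub>R (y - y')) < e" for y y' c
  proof -
    let ?h = "c *\<^sub>R (y - y')"
    have hB: "?h \<in> BHt J" using y sub_BHt by (intro subspace_mul subspace_diff)
    have z: "UT y ?h y' \<in> \<Omega>" by (rule in_Omega) (use y hB h in auto)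
    have "c *\<^sub>R (f y - f y') - l ?h = sandwich P1 E2 (f (UT y ?h y') - f (UT x ?h x))"
      using nc_function_UT[OF nc _ _ z] ball y
      by (simp add: l_def linear_diff[OF linear_sandwich] corner_UT)
    then have "norm (c *\<^sub>R (f y - f y') - l ?h) \<le> norm (f (UT y ?h y') - f (UT x ?h x))"
      using norm_sandwich_le[OF norms(3) norms(2)] by (simp only:)
    also have "\<dots> \<le> K * (norm (y - x) + norm (y' - x))" by (rule close) (use y hB h in auto)
    finally show ?thesis .
  qed
  \<comment> \<open>All four blocks are found as a limit: along \<open>y t = x + t h\<close> the
    factor \<open>1 / t\<close> keeps the corner equal to \<open>h\<close>, where the shear identity
    gives the value exactly. Then \<open>t\<close> tends to \<open>0\<close>.\<close>
  have full: "f (UT x h x) = UT (f x) (l h) (f x)" if hB: "h \<in> BHt J" and h: "norm h < e" for h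
  proof -
    define y where "y t = x + t *\<^sub>R h" for t :: real
    have yB: "y t \<in> BHt J" for t
      unfolding y_def using xB hB sub_BHt by (intro subspace_add subspace_mul)
    have y_lim: "((\<lambda>t. norm (y t - x)) \<longlongrightarrow> 0) (at 0)"
    proof -
      have "((\<lambda>t. norm (t *\<^sub>R h)) \<longlongrightarrow> norm (0 *\<^sub>R h)) (at (0::real))"
        by (intro tendsto_intros)
      then show ?thesis by (simp add: y_def)
    qed
    have ev: "eventually (\<lambda>t. norm (y t - x) < e \<and> t \<noteq> 0) (at 0)"
      by (intro eventually_conj order_tendstoD(2)[OF y_lim e]) (simp add: eventually_at_filter)
    have Ky: "((\<lambda>t. K * (norm (y t - x) + norm (x - x))) \<longlongrightarrow> 0) (at 0)"
      using tendsto_mult[OF tendsto_const[of K] tendsto_add[OF y_lim tendsto_const[of "norm (x - x)"]]] by simp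
    have h_eq: "(1 / t) *\<^sub>R (y t - x) = h" if "t \<noteq> 0" for t using that by (simp add: y_def)
    have q: "((\<lambda>t. (1 / t) *\<^sub>R (f (y t) - f x)) \<longlongrightarrow> l h) (at 0)"
    proof (rule Lim_transform[OF tendsto_const[of "l h"]], rule Lim_null_comparison[OF _ Ky])
      show "eventually (\<lambda>t. norm ((1 / t) *\<^sub>R (f (y t) - f x) - l h) \<le> K * (norm (y t - x) + norm (x - x))) (at 0)"
        using ev
      proof eventually_elim
        case (elim t)
        then have "(1 / t) *\<^sub>R (y t - x) = h" using h_eq by blast
        then show ?case using quot[OF yB xB, of t "1 / t"] elim h e by simp
      qed
    qed
    have fy: "((\<lambda>t. f (y t)) \<longlongrightarrow> f x) (at 0)"
    proof -
      have id: "((\<lambda>t::real. t) \<longlongrightarrow> 0) (at 0)" by (rule tendsto_ident_at)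
      \<comment> \<open>Continuity along the line follows from the limit of the quotients, by
        writing \<open>f (y t)\<close> as \<open>t\<close> times the quotient plus
        \<open>f x\<close>.\<close>
      have "((\<lambda>t. t *\<^sub>R ((1 / t) *\<^sub>R (f (y t) - f x)) + f x) \<longlongrightarrow> 0 *\<^sub>R l h + f x) (at 0)"
        by (intro tendsto_intros q id)
      then have "((\<lambda>t. t *\<^sub>R ((1 / t) *\<^sub>R (f (y t) - f x)) + f x) \<longlongrightarrow> f x) (at 0)" by simp
      then show ?thesis
        by (rule Lim_transform_eventually) (simp add: eventually_at_filter)
    qed
    have A: "((\<lambda>t. UT (f (y t)) ((1 / t) *\<^sub>R (f (y t) - f x)) (f x)) \<longlongrightarrow> UT (f x) (l h) (f x)) (at 0)"
      by (intro tendsto_UT fy q tendsto_const)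
    have "((\<lambda>t. UT (f (y t)) ((1 / t) *\<^sub>R (f (y t) - f x)) (f x)) \<longlongrightarrow> f (UT x h x)) (at 0)"
    proof (rule Lim_transform[OF tendsto_const[of "f (UT x h x)"]], rule Lim_null_comparison[OF _ Ky])
      show "eventually (\<lambda>t. norm (UT (f (y t)) ((1 / t) *\<^sub>R (f (y t) - f x)) (f x) - f (UT x h x))
          \<le> K * (norm (y t - x) + norm (x - x))) (at 0)"
        using ev
      proof eventually_elim
        case (elim t)
        have z: "UT (y t) h x \<in> \<Omega>" using in_Omega yB xB hB h e elim by simp
        have "f (UT (y t) h x) = UT (f (y t)) ((1 / t) *\<^sub>R (f (y t) - f x)) (f x)"
          using nc_function_UT[OF nc ball[OF yB] x, of t "1 / t"] elim z h_eq[of t] by simp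
        then show ?case using close[OF yB xB hB, of t] elim h e by simp
      qed
    qed
    from tendsto_unique[OF _ this A] show ?thesis by simp
  qed
  show thesis
  proof (rule that[of e K l])
    show "UT x h x \<in> \<Omega>" if "h \<in> BHt J" "norm h < e" for h
      using in_Omega[OF xB xB] that e by simp
  qed (fact e K ball full quot)+
qed

text \<open>\<open>T \<mapsto> (T - J T J)/2\<close>, needed because \<open>has_derivative\<close> asks for a derivative defined on all
  real-linear tuples while \<open>\<Omega>\<close> only determines it on \<open>BHt J\<close>.\<close>
lemma complex_linear_projection:
  obtains Q :: "('h \<Rightarrow>\<^sub>L 'h) ^ 'n \<Rightarrow> ('h \<Rightarrow>\<^sub>L 'h) ^ 'n"
  where "bounded_linear Q" "\<And>x. Q x \<in> BHt J" "\<And>x. x \<in> BHt J \<Longrightarrow> Q x = x"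
proof -
  have JJ: "J (J v) = - v" and norm_J: "norm (J v) = norm v" for v
    using J by (auto simp: complex_structure_def norm_eq_sqrt_inner)
  have "bounded_linear J"
    by (rule bounded_linear_intro[where K = 1])
      (simp_all add: linear_add[OF linear_J] linear_cmul[OF linear_J] norm_J)
  define I where "I = Blinfun J"
  have I: "blinfun_apply I = J"
    unfolding I_def by (rule bounded_linear_Blinfun_apply) fact
  have norm_I: "norm I \<le> 1" by (rule norm_blinfun_bound) (simp_all add: I norm_J)
  define Q :: "('h \<Rightarrow>\<^sub>L 'h) ^ 'n \<Rightarrow> ('h \<Rightarrow>\<^sub>L 'h) ^ 'n"
    where "Q x = (1/2) *\<^sub>R (x - sandwich I I x)" for x
  show thesis
  proof
    show "bounded_linear Q"
      unfolding Q_def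
      by (intro bounded_linear_compose[OF bounded_linear_scaleR_right] bounded_linear_sub
          bounded_linear_ident bounded_linear_sandwich norm_I)
    show "Q x \<in> BHt J" for x
      by (simp add: Q_def BHt_def BH_def sandwich_def blinfun.bilinear_simps I JJ
          linear_cmul[OF linear_J] linear_diff[OF linear_J])
    show "Q x = x" if "x \<in> BHt J" for x
    proof -
      have "sandwich I I x = - x"
        using that by (auto simp: sandwich_def BHt_def BH_def vec_eq_iff I JJ blinfun.bilinear_simps
            intro!: blinfun_eqI)
      then show ?thesis by (simp add: Q_def flip: scaleR_2)
    qed
  qed
qed

text \<open>Limits \<open>m\<close> of difference quotients extend \<open>l\<close> from the small
  ball to \<open>BHt J\<close>, and precomposing with the projection \<open>Q\<close> extends them
  to all tuples. The two-point estimate gives linearity and a quadratic remainder.\<close>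

lemma derivative_UT:
  assumes fr: "block_frame J E1 E2 P1 P2" and x: "x \<in> \<Omega>"
    and p: "block_frame.UT E1 E2 P1 P2 x 0 x \<in> \<Omega>"
  shows "\<exists>L. (f has_derivative L) (at x within \<Omega>) \<and>
    (\<exists>e>0. \<forall>h\<in>BHt J. norm h < e \<longrightarrow> block_frame.UT E1 E2 P1 P2 x h x \<in> \<Omega> \<and>
      f (block_frame.UT E1 E2 P1 P2 x h x) = block_frame.UT E1 E2 P1 P2 (f x) (L h) (f x))"
proof (rule UT_limit[OF fr x p])
  fix e K :: real and l :: "('h \<Rightarrow>\<^sub>L 'h) ^ 'd \<Rightarrow> ('h \<Rightarrow>\<^sub>L 'h) ^ 'r"
  assume e: "e > 0" and K: "K \<ge> 0"
    and ball: "\<And>y. y \<in> BHt J \<Longrightarrow> norm (y - x) < e \<Longrightarrow> y \<in> \<Omega>"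
    and dom: "\<And>h. h \<in> BHt J \<Longrightarrow> norm h < e \<Longrightarrow> block_frame.UT E1 E2 P1 P2 x h x \<in> \<Omega>"
    and val: "\<And>h. h \<in> BHt J \<Longrightarrow> norm h < e \<Longrightarrow>
      f (block_frame.UT E1 E2 P1 P2 x h x) = block_frame.UT E1 E2 P1 P2 (f x) (l h) (f x)"
    and quot: "\<And>y y' c. y \<in> BHt J \<Longrightarrow> y' \<in> BHt J \<Longrightarrow> norm (y - x) < e \<Longrightarrow> norm (y' - x) < e \<Longrightarrow>
      norm (c *\<^sub>R (y - y')) < e \<Longrightarrow>
      norm (c *\<^sub>R (f y - f y') - l (c *\<^sub>R (y - y'))) \<le> K * (norm (y - x) + norm (y' - x))"
  have xB: "x \<in> BHt J" using x sub by blast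
  note BHt_intros = subspace_add[OF sub_BHt] subspace_mul[OF sub_BHt] subspace_diff[OF sub_BHt]
  \<comment> \<open>The base point \<open>x + t h\<close> moves with \<open>t\<close>, so that
    quotients in directions \<open>h\<close> and \<open>g\<close> can be telescoped.\<close>
  define q where "q h g t = (1 / t) *\<^sub>R (f (x + t *\<^sub>R h + t *\<^sub>R g) - f (x + t *\<^sub>R h))" for h g t
  have nonzero: "eventually (\<lambda>t::real. t \<noteq> 0) (at 0)" by (simp add: eventually_at_filter)
  have line: "((\<lambda>t. norm (x + t *\<^sub>R h - x)) \<longlongrightarrow> 0) (at 0)" for h
  proof -
    have "((\<lambda>t. norm (t *\<^sub>R h)) \<longlongrightarrow> norm (0 *\<^sub>R h)) (at (0::real))"
      by (intro tendsto_intros)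
    then show ?thesis by simp
  qed
  have q_lim: "(q h g \<longlongrightarrow> (1 / a) *\<^sub>R l (a *\<^sub>R g)) (at 0)"
    if h: "h \<in> BHt J" and g: "g \<in> BHt J" and a: "a > 0" "norm (a *\<^sub>R g) < e" for h g a
  proof -
    have rw: "x + t *\<^sub>R h + t *\<^sub>R g = x + t *\<^sub>R (h + g)" for t by (simp add: scaleR_add_right)
    let ?b = "\<lambda>t. K * (norm (x + t *\<^sub>R (h + g) - x) + norm (x + t *\<^sub>R h - x))"
    have b: "(?b \<longlongrightarrow> 0) (at 0)"
      using tendsto_mult[OF tendsto_const[of K] tendsto_add[OF line line]] by simp
    have "((\<lambda>t. a *\<^sub>R q h g t) \<longlongrightarrow> l (a *\<^sub>R g)) (at 0)"
    proof (rule Lim_transform[OF tendsto_const[of "l (a *\<^sub>R g)"]], rule Lim_null_comparison[OF _ b])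
      show "eventually (\<lambda>t. norm (a *\<^sub>R q h g t - l (a *\<^sub>R g)) \<le> ?b t) (at 0)"
        using nonzero order_tendstoD(2)[OF line e, of "h + g"] order_tendstoD(2)[OF line e, of h]
      proof eventually_elim
        case (elim t)
        have eq: "(a / t) *\<^sub>R (x + t *\<^sub>R (h + g) - (x + t *\<^sub>R h)) = a *\<^sub>R g"
          using elim(1) by (simp add: algebra_simps)
        have "norm ((a / t) *\<^sub>R (f (x + t *\<^sub>R (h + g)) - f (x + t *\<^sub>R h)) - l (a *\<^sub>R g)) \<le> ?b t"
          using quot[of "x + t *\<^sub>R (h + g)" "x + t *\<^sub>R h" "a / t", unfolded eq] elim a
          by (simp add: BHt_intros xB h g)
        then show ?case by (simp add: q_def rw)
      qed
    qed
    from tendsto_scaleR[OF tendsto_const[of "1 / a"] this] show ?thesis using a by simp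
  qed
  \<comment> \<open>The limit does not depend on \<open>h\<close>, so one value \<open>m g\<close>
    serves all moving base points.\<close>
  have "\<exists>m. \<forall>h\<in>BHt J. (q h g \<longlongrightarrow> m) (at 0)" if "g \<in> BHt J" for g
    using ex_small_scaleR[OF e, of g] q_lim that by blast
  then obtain m where m: "\<And>g h. g \<in> BHt J \<Longrightarrow> h \<in> BHt J \<Longrightarrow> (q h g \<longlongrightarrow> m g) (at 0)"
    by metis
  have zB: "0 \<in> BHt J" by (rule subspace_0[OF sub_BHt])
  have m_eq: "m g = (1 / a) *\<^sub>R l (a *\<^sub>R g)" if "g \<in> BHt J" "a > 0" "norm (a *\<^sub>R g) < e" for g a
    using tendsto_unique[OF _ m[OF that(1) zB] q_lim[OF zB that]] by simp
  have m_add: "m (h + g) = m h + m g" if h: "h \<in> BHt J" and g: "g \<in> BHt J" for h g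
  proof -
    have "((\<lambda>t. q 0 h t + q h g t) \<longlongrightarrow> m h + m g) (at 0)"
      by (intro tendsto_add m h g zB)
    \<comment> \<open>The intermediate value \<open>f (x + t h)\<close> cancels.\<close>
    moreover have "q 0 h t + q h g t = q 0 (h + g) t" for t
      by (simp add: q_def algebra_simps flip: scaleR_add_right)
    ultimately show ?thesis
      using tendsto_unique[OF _ m[OF BHt_intros(1)[OF h g] zB]] by simp
  qed
  have m_scale: "m (r *\<^sub>R g) = r *\<^sub>R m g" if g: "g \<in> BHt J" for r g
  proof (cases "r = 0")
    case True
    then show ?thesis using m_add[OF zB zB] by simp
  next
    case False
    \<comment> \<open>Homogeneity, for negative \<open>r\<close> as well, by the substitution of
      \<open>r * t\<close> for \<open>t\<close>.\<close>
    have "filterlim (\<lambda>t. r * t) (at 0) (at (0::real))"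
    proof (rule filterlim_atI)
      have "((\<lambda>t. r * t) \<longlongrightarrow> r * 0) (at (0::real))" by (intro tendsto_intros)
      then show "((\<lambda>t. r * t) \<longlongrightarrow> 0) (at (0::real))" by simp
      show "eventually (\<lambda>t. r * t \<noteq> 0) (at 0)" using nonzero False by simp
    qed
    from filterlim_compose[OF m[OF g zB] this]
    have "((\<lambda>t. r *\<^sub>R q 0 g (r * t)) \<longlongrightarrow> r *\<^sub>R m g) (at 0)"
      by (intro tendsto_scaleR tendsto_const)
    moreover have "r *\<^sub>R q 0 g (r * t) = q 0 (r *\<^sub>R g) t" for t
      using False by (simp add: q_def mult.commute)
    ultimately show ?thesis
      using tendsto_unique[OF _ m[OF BHt_intros(2)[OF g] zB]] by simp
  qed
  obtain d C where d: "d > 0" and C: "C \<ge> 0"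
    and lip: "\<And>y y'. \<lbrakk>y \<in> BHt J; y' \<in> BHt J; norm (y - x) < d; norm (y' - x) < d\<rbrakk> \<Longrightarrow>
      y \<in> \<Omega> \<and> norm (f y - f y') \<le> C * norm (y - y')"
    using locally_lipschitz[OF x] by meson
  have m_bound: "norm (m g) \<le> C * norm g" if g: "g \<in> BHt J" for g
  proof (rule tendsto_upperbound[OF tendsto_norm[OF m[OF g zB]]])
    show "eventually (\<lambda>t. norm (q 0 g t) \<le> C * norm g) (at 0)"
      using nonzero order_tendstoD(2)[OF line d, of g]
    proof eventually_elim
      case (elim t)
      have "norm (f (x + t *\<^sub>R g) - f x) \<le> C * norm (t *\<^sub>R g)"
        using lip[of "x + t *\<^sub>R g" x] elim d by (simp add: BHt_intros xB g)
      moreover have "norm (q 0 g t) = norm (f (x + t *\<^sub>R g) - f x) / \<bar>t\<bar>"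
        by (simp add: q_def)
      ultimately show ?case using elim(1) by (simp add: divide_le_eq mult_ac)
    qed
  qed simp
  obtain Q :: "('h \<Rightarrow>\<^sub>L 'h) ^ 'd \<Rightarrow> ('h \<Rightarrow>\<^sub>L 'h) ^ 'd" where Q: "bounded_linear Q"
    and QB: "\<And>x. Q x \<in> BHt J" and Q_id: "\<And>x. x \<in> BHt J \<Longrightarrow> Q x = x"
    using complex_linear_projection by blast
  define L where "L h = m (Q h)" for h
  have L: "bounded_linear L"
  proof -
    obtain B where B: "norm (Q h) \<le> norm h * B" for h using bounded_linear.bounded[OF Q] by blast
    show ?thesis
    proof (rule bounded_linear_intro)
      show "L (g + h) = L g + L h" for g h
        by (simp add: L_def m_add QB linear_add[OF bounded_linear.linear[OF Q]])
      show "L (r *\<^sub>R g) = r *\<^sub>R L g" for r g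
        by (simp add: L_def m_scale QB linear_cmul[OF bounded_linear.linear[OF Q]])
      show "norm (L g) \<le> norm g * (B * C)" for g
      proof -
        have "norm (L g) \<le> C * norm (Q g)" unfolding L_def by (rule m_bound[OF QB])
        also have "\<dots> \<le> C * (norm g * B)" using B C by (intro mult_left_mono)
        finally show ?thesis by (simp add: mult_ac)
      qed
    qed
  qed
  have L_l: "L h = l h" if "h \<in> BHt J" "norm h < e" for h
    using m_eq[of h 1] that by (simp add: L_def Q_id)
  have quadratic: "norm (f y - f x - L (y - x)) \<le> 2 * K / e * norm (y - x) * norm (y - x)"
    if y: "y \<in> \<Omega>" and near: "norm (y - x) < e" for y
  proof (cases "y = x")
    case True
    then show ?thesis using linear_0[OF bounded_linear.linear[OF L]] by simp
  next
    case False
    have yB: "y \<in> BHt J" using y sub by blast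
    have hB: "y - x \<in> BHt J" using yB xB by (intro BHt_intros)
    \<comment> \<open>This scales \<open>y - x\<close> to norm \<open>e / 2\<close>, inside the ball
      where \<open>l\<close> is controlled. Dividing by \<open>a\<close> afterwards contributes the
      second factor \<open>norm (y - x)\<close>.\<close>
    define a where "a = e / (2 * norm (y - x))"
    have a: "a > 0" using False e by (simp add: a_def)
    have an: "norm (a *\<^sub>R (y - x)) < e" using False e by (simp add: a_def)
    have "a *\<^sub>R (f y - f x - L (y - x)) = a *\<^sub>R (f y - f x) - l (a *\<^sub>R (y - x))"
      using L_l[OF BHt_intros(2)[OF hB] an]
      by (simp only: scaleR_diff_right[of a "f y - f x"] linear_cmul[OF bounded_linear.linear[OF L]])
    then have "a * norm (f y - f x - L (y - x)) \<le> K * norm (y - x)"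
      using quot[OF yB xB near _ an] e a by simp (metis abs_of_pos norm_scaleR)
    then have "norm (f y - f x - L (y - x)) \<le> K * norm (y - x) / a"
      using a by (simp add: field_simps)
    then show ?thesis using False by (simp add: a_def field_simps)
  qed
  have "(f has_derivative L) (at x within \<Omega>)"
    unfolding has_derivative_within_alt
  proof (intro conjI L allI impI)
    fix \<epsilon> :: real assume eps: "\<epsilon> > 0"
    \<comment> \<open>The summand \<open>1\<close> keeps \<open>D\<close> positive when
      \<open>K = 0\<close>.\<close>
    define D where "D = 2 * K / e + 1"
    have D: "D > 0" using K e by (simp add: D_def add_nonneg_pos)
    have "norm (f y - f x - L (y - x)) \<le> \<epsilon> * norm (y - x)"
      if y: "y \<in> \<Omega>" and near: "norm (y - x) < min e (\<epsilon> / D)" for y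
    proof -
      have "norm (f y - f x - L (y - x)) \<le> (2 * K / e * norm (y - x)) * norm (y - x)"
        using quadratic[OF y] near by simp
      also have "\<dots> \<le> (D * (\<epsilon> / D)) * norm (y - x)"
        using near K e D by (intro mult_right_mono mult_mono) (auto simp: D_def)
      finally show ?thesis using D by simp
    qed
    then show "\<exists>d>0. \<forall>y\<in>\<Omega>. norm (y - x) < d \<longrightarrow> norm (f y - f x - L (y - x)) \<le> \<epsilon> * norm (y - x)"
      using e eps D by (intro exI[of _ "min e (\<epsilon> / D)"]) simp
  qed
  then show ?thesis
    using e dom val L_l by (intro exI[of _ L] conjI exI[of _ e]) simp_all
qed

section \<open>Injectivity\<close>

text \<open>A kernel vector of the derivative, scaled into the range of the block formula, can be
  put in the corner of \<open>UT x 0 x\<close> without changing the value of \<open>f\<close>;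
  injectivity of \<open>f\<close> makes it zero.\<close>

lemma inj_on_derivative:
  assumes inj: "inj_on f \<Omega>" and x: "x \<in> \<Omega>"
  shows "\<exists>L. (f has_derivative L) (at x within \<Omega>) \<and> inj_on L (BHt J)"
proof -
  obtain E1 E2 P1 P2 where fr: "block_frame J E1 E2 P1 P2"
    and p: "block_frame.UT E1 E2 P1 P2 x 0 x \<in> \<Omega>"
    using frame[OF x x] by blast
  interpret block_frame J E1 E2 P1 P2 by (fact fr)
  obtain L e where L: "(f has_derivative L) (at x within \<Omega>)" and e: "e > 0"
    and U: "\<And>h. h \<in> BHt J \<Longrightarrow> norm h < e \<Longrightarrow> UT x h x \<in> \<Omega> \<and> f (UT x h x) = UT (f x) (L h) (f x)"
    using derivative_UT[OF fr x p] by blast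
  have lin: "linear L" using L by (intro bounded_linear.linear has_derivative_bounded_linear)
  have "inj_on L (BHt J)"
  proof (rule inj_onI)
    fix g h assume g: "g \<in> BHt J" and h: "h \<in> BHt J" and eq: "L g = L h"
    obtain c where c: "c > 0" "norm (c *\<^sub>R (g - h)) < e"
      using ex_small_scaleR[OF e] by blast
    have kB: "c *\<^sub>R (g - h) \<in> BHt J"
      using g h sub_BHt by (intro subspace_mul subspace_diff)
    have "L (c *\<^sub>R (g - h)) = 0"
      using eq by (simp add: linear_cmul[OF lin] linear_diff[OF lin])
    then have "f (UT x (c *\<^sub>R (g - h)) x) = f (UT x 0 x)"
      using U[OF kB c(2)] U[OF subspace_0[OF sub_BHt]] e linear_0[OF lin] by simp
    then have "UT x (c *\<^sub>R (g - h)) x = UT x 0 x"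
      by (rule inj_onD[OF inj]) (use U[OF kB c(2)] p in auto)
    then have "c *\<^sub>R (g - h) = 0" by (rule UT_inject)
    then show "g = h" using c by simp
  qed
  with L show ?thesis by blast
qed

text \<open>When \<open>f a = f b\<close>, the corner \<open>t (f a - f b)\<close> vanishes, so
  \<open>f\<close> is constant on the segment through \<open>a \<oplus> b\<close> in direction
  \<open>w\<close>. Hence the derivative there kills \<open>w\<close>, whose corner is
  \<open>a - b\<close>.\<close>

lemma inj_on_of_derivative:
  assumes D: "\<And>x. x \<in> \<Omega> \<Longrightarrow> \<exists>L. (f has_derivative L) (at x within \<Omega>) \<and> inj_on L (BHt J)"
  shows "inj_on f \<Omega>"
proof (rule inj_onI)
  fix a b assume a: "a \<in> \<Omega>" and b: "b \<in> \<Omega>" and fab: "f a = f b"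
  obtain E1 E2 P1 P2 where fr: "block_frame J E1 E2 P1 P2"
    and p: "block_frame.UT E1 E2 P1 P2 a 0 b \<in> \<Omega>"
    using frame[OF a b] by blast
  interpret block_frame J E1 E2 P1 P2 by (fact fr)
  obtain L where L: "(f has_derivative L) (at (UT a 0 b) within \<Omega>)" and inj: "inj_on L (BHt J)"
    using D[OF p] by blast
  obtain e M where e: "e > 0" and ball: "\<And>y. y \<in> BHt J \<Longrightarrow> norm (y - UT a 0 b) < e \<Longrightarrow> y \<in> \<Omega>"
    using locally_bounded[OF p] by blast
  have aB: "a \<in> BHt J" and bB: "b \<in> BHt J" using a b sub by auto
  note zB = subspace_0[OF sub_BHt]
  define w where "w = UT 0 (a - b) 0"
  have wB: "w \<in> BHt J"
    unfolding w_def using aB bB by (intro UT_BHt zB subspace_diff[OF sub_BHt])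
  have path: "UT a 0 b + t *\<^sub>R w = UT a (t *\<^sub>R (a - b)) b" for t
    by (simp add: w_def UT_def linear_0[OF linear_sandwich] linear_cmul[OF linear_sandwich])
  define r where "r = e / (norm w + 1)"
  have pos: "norm w + 1 > 0" by (smt (verit) norm_ge_zero)
  have r: "r > 0" using e pos by (simp add: r_def)
  have in_Omega: "UT a 0 b + t *\<^sub>R w \<in> \<Omega>" if "t \<in> ball 0 r" for t
  proof (rule ball)
    show "UT a 0 b + t *\<^sub>R w \<in> BHt J"
      using p sub wB by (intro subspace_add[OF sub_BHt] subspace_mul[OF sub_BHt]) auto
    have "\<bar>t\<bar> * norm w \<le> \<bar>t\<bar> * (norm w + 1)" by (simp add: mult_left_mono)
    also have "\<dots> < e" using that pos by (simp add: r_def field_simps)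
    finally show "norm (UT a 0 b + t *\<^sub>R w - UT a 0 b) < e" by simp
  qed
  have const: "f (UT a 0 b + t *\<^sub>R w) = UT (f a) 0 (f b)" if "t \<in> ball 0 r" for t
    using nc_function_UT[OF nc a b, of t] in_Omega[OF that] fab by (simp add: path)
  \<comment> \<open>The chain rule is applied within \<open>ball 0 r\<close>, where the path stays
    in \<open>\<Omega>\<close>; this ball being open, the result is a derivative at
    \<open>0\<close>.\<close>
  have "((\<lambda>t. UT a 0 b + t *\<^sub>R w) has_derivative (\<lambda>t. t *\<^sub>R w)) (at 0 within ball 0 r)"
    by (auto intro!: derivative_eq_intros)
  then have "((\<lambda>t. f (UT a 0 b + t *\<^sub>R w)) has_derivative (\<lambda>t. L (t *\<^sub>R w))) (at 0 within ball 0 r)"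
    by (rule has_derivative_in_compose)
      (use L in_Omega in \<open>auto intro!: has_derivative_subset[of f L _ \<Omega>]\<close>)
  then have "((\<lambda>t. UT (f a) 0 (f b)) has_derivative (\<lambda>t. L (t *\<^sub>R w))) (at 0 within ball 0 r)"
    by (rule has_derivative_transform[rotated 2]) (use r const in auto)
  then have "((\<lambda>t. UT (f a) 0 (f b)) has_derivative (\<lambda>t. L (t *\<^sub>R w))) (at (0::real))"
    using r by (simp add: at_within_open[of 0 "ball 0 r"])
  then have "(\<lambda>t. L (t *\<^sub>R w)) = (\<lambda>t::real. 0)"
    by (rule has_derivative_unique) simp
  from fun_cong[OF this, of 1] have "L w = 0" by simp
  moreover have "L 0 = 0"
    using L by (intro linear_0 bounded_linear.linear has_derivative_bounded_linear)
  ultimately have "w = 0" using inj wB zB by (metis inj_onD)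
  also have "0 = UT 0 0 0" by (simp add: UT_def linear_0[OF linear_sandwich])
  finally have "a - b = 0" unfolding w_def by (rule UT_inject)
  then show "a = b" by simp
qed

end

section \<open>From the exhaustion to the local hypotheses\<close>

lemma nc_local_of_nc_domain:
  fixes J :: "'h::{real_inner,complete_space} \<Rightarrow> 'h"
    and f :: "('h \<Rightarrow>\<^sub>L 'h) ^ 'd \<Rightarrow> ('h \<Rightarrow>\<^sub>L 'h) ^ 'r"
  assumes J: "complex_structure J" and dom: "nc_domain J \<Omega>" and f: "nc_function J \<Omega> f"
  shows "nc_local J \<Omega> f"
proof -
  obtain X :: "nat \<Rightarrow> (('h \<Rightarrow>\<^sub>L 'h) ^ 'd) set" where sub: "\<Omega> \<subseteq> BHt J"
    and int: "\<forall>k. X k \<subseteq> bint J (X (Suc k))" and Un: "\<Omega> = (\<Union>k. X k)"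
    and sums: "\<forall>k. sum_closed J (X k)"
    using dom unfolding nc_domain_def sum_closed_def by blast
  have lin: "linear J" using J by (simp add: complex_structure_def)
  \<comment> \<open>A point of the interior of a set lies in the set, so the pieces increase and two
    points of \<open>\<Omega>\<close> share a piece.\<close>
  have "X k \<subseteq> X (Suc k)" for k
    using int sub Un by (fastforce simp: bint_def)
  then have mono: "X i \<subseteq> X j" if "i \<le> j" for i j
    using that by (rule lift_Suc_mono_le)
  show ?thesis
  proof
    fix p assume "p \<in> \<Omega>"
    then obtain k where "p \<in> bint J (X (Suc k))" using Un int by blast
    then obtain e where e: "e > 0" and ball: "\<forall>y\<in>BHt J. dist y p < e \<longrightarrow> y \<in> X (Suc k)"
      unfolding bint_def by blast
    obtain M where "\<forall>x\<in>X (Suc k). norm (f x) \<le> M"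
      using nc_function_bounded[of J "X (Suc k)"] sums lin f Un by blast
    then show "\<exists>e>0. \<exists>M. \<forall>y\<in>BHt J. norm (y - p) < e \<longrightarrow> y \<in> \<Omega> \<and> norm (f y) \<le> M"
      using e ball Un by (intro exI[of _ e] exI[of _ M]) (auto simp: dist_norm)
  next
    fix x y assume "x \<in> \<Omega>" "y \<in> \<Omega>"
    then obtain i j where "x \<in> X i" "y \<in> X j" using Un by blast
    then have xy: "x \<in> X (max i j)" "y \<in> X (max i j)"
      using mono[of i "max i j"] mono[of j "max i j"] by auto
    have "sum_closed J (X (max i j))" using sums by blast
    from sum_closed_pair[OF this lin xy]
    show "\<exists>E1 E2 P1 P2. block_frame J E1 E2 P1 P2 \<and> block_frame.UT E1 E2 P1 P2 x 0 y \<in> \<Omega>"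
      using Un by (metis UN_I UNIV_I)
  qed (fact J f sub)+
qed

theorem theorem3p4:
  fixes J :: "'h::{real_inner,complete_space} \<Rightarrow> 'h"
    and \<Omega> :: "(('h \<Rightarrow>\<^sub>L 'h) ^ 'd) set"
    and f :: "('h \<Rightarrow>\<^sub>L 'h) ^ 'd \<Rightarrow> ('h \<Rightarrow>\<^sub>L 'h) ^ 'r"
  assumes "sep_inf_hilbert J"
    and "nc_domain J \<Omega>"
    and "nc_function J \<Omega> f"
  shows "inj_on f \<Omega> \<longleftrightarrow>
    (\<forall>x \<in> \<Omega>. \<exists>L. (f has_derivative L) (at x within \<Omega>) \<and> inj_on L (BHt J))"
proof -
  interpret nc_local J \<Omega> f
    using assms by (intro nc_local_of_nc_domain) (auto simp: sep_inf_hilbert_def)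
  show ?thesis
    using inj_on_derivative inj_on_of_derivative by blast
qed

end
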